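(* An ultrafilter on $\omega$ $\mathcal{N}$-diagonalizes trees if and only if it is a measure zero ultrafilter. Consequently, every (non-principal) measure zero ultrafilter is a $\mu$-point of $\omega^\ast$.
   Context: For $A,B\subseteq\omega$ write $A\subseteq^\ast B$ if $A\setminus B$ is finite and $A=^\ast B$ if $A\triangle B$ is finite. A tree of subsets of $\omega$ is a family $\mathcal{T}=\{T_s: s\in 2^{<\omega}\}$ with $T_s\subseteq\omega$ such that: if $s$ extends $t$ then $T_s\subseteq^\ast T_t$; and for every $k\in\omega$, $\bigcup\{T_s: s\in 2^k\}=^\ast\omega$ and $T_s\cap T_t=^\ast\emptyset$ for distinct $s,t\in 2^k$ (the $T_s$ may be empty). For $X\subseteq\omega$ let $T_X=\{x\in 2^\omega: \forall k\ T_{x|k}\cap X \text{ is infinite}\}$. $\mathcal{N}$ is the $\sigma$-ideal of Lebesgue (Haar) measure zero subsets of $2^\omega$. An ultrafilter $\mathcal{U}$ on $\omega$ $\mathcal{N}$-diagonalizes trees if for every tree $\mathcal{T}$ of subsets of $\omega$ there is $X\in\mathcal{U}$ with $T_X\in\mathcal{N}$. An ultrafilter $\mathcal{U}$ on $\omega$ is a measure zero ultrafilter if for every function $f\colon\omega\to 2^\omega$ there is $X\in\mathcal{U}$ such that $\overline{f[X]}\in\mathcal{N}$. $\omega^\ast=\beta\omega\setminus\omega$ is the space of non-principal ultrafilters on $\omega$. A measure on a topological space is a $\sigma$-additive Radon probability measure on its Borel sets; it is non-atomic if it vanishes on singletons; its support is the intersection of all closed sets of measure $1$. A point $x$ of a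 space is a $\mu$-point if $x\notin\mathrm{supp}(\nu)$ for every non-atomic measure $\nu$ on the space. *)

theory Defs
  imports "HOL-Probability.Probability" "HOL-Library.Sublist"
begin

section \<open>Trees of subsets of the natural numbers\<close>

definition almost_subset :: "nat set \<Rightarrow> nat set \<Rightarrow> bool" where
  "almost_subset A B \<longleftrightarrow> finite (A - B)"

definition almost_eq :: "nat set \<Rightarrow> nat set \<Rightarrow> bool" where
  "almost_eq A B \<longleftrightarrow> finite ((A - B) \<union> (B - A))"

text \<open>Finite binary sequences are lists of booleans, points of the Cantor space are functions
  of type \<^typ>\<open>nat \<Rightarrow> bool\<close>; the library topology on that type is the product of the discrete
  topologies.\<close>

definition tree_of_sets :: "(bool list \<Rightarrow> nat set) \<Rightarrow> bool" where
  "tree_of_sets T \<longleftrightarrow>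
     (\<forall>s t. prefix t s \<longrightarrow> almost_subset (T s) (T t)) \<and>
     (\<forall>k. almost_eq (\<Union>s\<in>{s. length s = k}. T s) UNIV \<and>
          (\<forall>s t. length s = k \<and> length t = k \<and> s \<noteq> t \<longrightarrow> almost_eq (T s \<inter> T t) {}))"

definition restr :: "(nat \<Rightarrow> bool) \<Rightarrow> nat \<Rightarrow> bool list" where
  "restr x k = map x [0..<k]"

definition tree_branches :: "(bool list \<Rightarrow> nat set) \<Rightarrow> nat set \<Rightarrow> (nat \<Rightarrow> bool) set" where
  "tree_branches T X = {x. \<forall>k. infinite (T (restr x k) \<inter> X)}"

section \<open>Null subsets of the Cantor space\<close>

definition haar_cantor :: "(nat \<Rightarrow> bool) measure" where
  "haar_cantor = PiM UNIV (\<lambda>_. uniform_count_measure UNIV)"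

text \<open>The completion makes every subset of a measurable null set a member of the ideal.\<close>

definition null_ideal :: "(nat \<Rightarrow> bool) set set" where
  "null_ideal = null_sets (completion haar_cantor)"

section \<open>Ultrafilters\<close>

definition in_filter :: "'a set \<Rightarrow> 'a filter \<Rightarrow> bool" where
  "in_filter X U \<longleftrightarrow> eventually (\<lambda>n. n \<in> X) U"

definition ultrafilter :: "'a filter \<Rightarrow> bool" where
  "ultrafilter U \<longleftrightarrow> U \<noteq> bot \<and> (\<forall>X. in_filter X U \<or> in_filter (- X) U)"

definition nonprincipal :: "'a filter \<Rightarrow> bool" where
  "nonprincipal U \<longleftrightarrow> (\<forall>n. U \<noteq> principal {n})"

definition N_diagonalizes_trees :: "nat filter \<Rightarrow> bool" where
  "N_diagonalizes_trees U \<longleftrightarrow>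
     (\<forall>T. tree_of_sets T \<longrightarrow> (\<exists>X. in_filter X U \<and> tree_branches T X \<in> null_ideal))"

definition measure_zero_ultrafilter :: "nat filter \<Rightarrow> bool" where
  "measure_zero_ultrafilter U \<longleftrightarrow> ultrafilter U \<and>
     (\<forall>f :: nat \<Rightarrow> (nat \<Rightarrow> bool). \<exists>X. in_filter X U \<and> closure (f ` X) \<in> null_ideal)"

section \<open>The remainder of the Stone-Cech compactification of the natural numbers\<close>

definition beta_omega :: "nat filter topology" where
  "beta_omega = topology_generated_by {{U. ultrafilter U \<and> in_filter A U} |A. True}"

definition omega_star :: "nat filter topology" where
  "omega_star = subtopology beta_omega {U. nonprincipal U}"

section \<open>Radon probability measures, supports and \<open>\<mu>\<close>-points\<close>

text \<open>For a probability measure, Radon means inner regular with respect to compact sets (local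
  finiteness is automatic). Compact sets are required to be Borel only because the spaces here
  are not assumed to be Hausdorff.\<close>

definition radon_probability :: "'a topology \<Rightarrow> 'a measure \<Rightarrow> bool" where
  "radon_probability S \<nu> \<longleftrightarrow>
     prob_space \<nu> \<and> space \<nu> = topspace S \<and>
     sets \<nu> = sigma_sets (topspace S) {G. openin S G} \<and>
     (\<forall>B\<in>sets \<nu>. emeasure \<nu> B =
        (SUP K\<in>{K. compactin S K \<and> K \<in> sets \<nu> \<and> K \<subseteq> B}. emeasure \<nu> K))"

definition non_atomic :: "'a topology \<Rightarrow> 'a measure \<Rightarrow> bool" where
  "non_atomic S \<nu> \<longleftrightarrow> (\<forall>x\<in>topspace S. emeasure \<nu> {x} = 0)"

definition measure_support :: "'a topology \<Rightarrow> 'a measure \<Rightarrow> 'a set" where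
  "measure_support S \<nu> = \<Inter> {C. closedin S C \<and> emeasure \<nu> C = 1}"

definition mu_point :: "'a topology \<Rightarrow> 'a \<Rightarrow> bool" where
  "mu_point S x \<longleftrightarrow> x \<in> topspace S \<and>
     (\<forall>\<nu>. radon_probability S \<nu> \<and> non_atomic S \<nu> \<longrightarrow> x \<notin> measure_support S \<nu>)"

end

theory Submission
  imports Defs
begin

text \<open>Up to finite errors, a tree is the family of preimages of the basic clopen sets under a map
  \<open>f\<close> into the Cantor space, and \<open>T\<^sub>X\<close> differs from the closure of \<open>f[X]\<close> by a countable set.
  This gives the equivalence. For the second part, a non-atomic Radon measure \<open>\<nu>\<close> on the
  remainder induces the charge \<open>m A = \<nu> A\<^sup>*\<close> on \<open>\<omega>\<close>. By compactness \<open>\<omega>\<close> is covered by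
  finitely many sets of arbitrarily small charge, so every set can be halved exactly, and iterated
  halving gives a map \<open>f\<close> under which \<open>m\<close> becomes the Haar measure on clopen sets. Hence the
  charge of \<open>X\<close> is at most the Haar measure of the closure of \<open>f[X]\<close>, and a set \<open>X\<close> in the
  ultrafilter for which this closure is null yields a clopen set of measure \<open>1\<close> missing the
  ultrafilter.\<close>

section \<open>The Cantor space\<close>

lemma length_restr [simp]: "length (restr x k) = k"
  by (simp add: restr_def)

lemma restr_eq_iff: "restr x k = restr y k \<longleftrightarrow> (\<forall>j<k. x j = y j)"
  by (auto simp: restr_def)

lemma restr_Suc: "restr x (Suc k) = restr x k @ [x k]"
  by (simp add: restr_def)

lemma restr_eq_mono: "j \<le> k \<Longrightarrow> restr x k = restr y k \<Longrightarrow> restr x j = restr y j"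
  by (auto simp: restr_eq_iff)

lemma prefix_restr: "j \<le> k \<Longrightarrow> prefix (restr x j) (restr x k)"
  by (metis add_diff_inverse_nat leD map_append prefixI restr_def upt_add_eq_append zero_le)

lemma take_restr: "j \<le> k \<Longrightarrow> take j (restr x k) = restr x j"
  by (simp add: restr_def take_map)

lemma restr_nth: "restr ((!) s) (length s) = s"
  by (simp add: restr_def map_nth)

lemma open_cylinder: "open {y. restr y k = restr x k}"
proof -
  have "open (Pi\<^sub>E UNIV (\<lambda>j. if j < k then {x j} else UNIV))"
    by (rule open_PiE) (auto simp: discrete_topology_class.open_discrete)
  also have "Pi\<^sub>E UNIV (\<lambda>j. if j < k then {x j} else UNIV) = {y. restr y k = restr x k}"
    by (auto simp: restr_eq_iff PiE_def Pi_def split: if_splits)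
  finally show ?thesis .
qed

lemma open_contains_cylinder:
  fixes G :: "(nat \<Rightarrow> bool) set"
  assumes "open G" "x \<in> G"
  obtains k where "{y. restr y k = restr x k} \<subseteq> G"
proof -
  obtain W where W: "finite {i. W i \<noteq> (UNIV::bool set)}" "x \<in> Pi\<^sub>E UNIV W" "Pi\<^sub>E UNIV W \<subseteq> G"
    using assms unfolding open_fun_def openin_product_topology_alt by auto
  obtain k where k: "\<And>i. W i \<noteq> UNIV \<Longrightarrow> i < k"
    using W(1) finite_nat_set_iff_bounded by auto
  have "y \<in> G" if "restr y k = restr x k" for y
  proof -
    have "y i \<in> W i" for i
      using k[of i] that W(2) by (cases "W i = UNIV") (auto simp: restr_eq_iff)
    then show ?thesis
      using W(3) by auto
  qed
  then show ?thesis
    using that by auto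
qed

text \<open>Cylinders form a neighbourhood base. In this form only finite restrictions of points
  matter.\<close>

lemma closure_cantor: "closure S = {x. \<forall>k. \<exists>y\<in>S. restr y k = restr x k}"
proof (intro set_eqI iffI CollectI allI)
  fix x k assume "x \<in> closure S"
  then have "{y. restr y k = restr x k} \<inter> S \<noteq> {}"
    using open_Int_closure_eq_empty[OF open_cylinder[of k x], of S] by auto
  then show "\<exists>y\<in>S. restr y k = restr x k"
    by auto
next
  fix x assume x: "x \<in> {x. \<forall>k. \<exists>y\<in>S. restr y k = restr x k}"
  show "x \<in> closure S"
  proof (rule ccontr)
    assume "x \<notin> closure S"
    then obtain k where "{y. restr y k = restr x k} \<subseteq> - closure S"
      using open_contains_cylinder[of "- closure S" x] by auto
    then show False
      using x closure_subset by blast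
  qed
qed

lemma finite_closed_cantor:
  fixes S :: "(nat \<Rightarrow> bool) set"
  assumes "finite S"
  shows "closed S"
proof -
  have "closure {x} = {x}" for x :: "nat \<Rightarrow> bool"
    unfolding closure_cantor by (auto simp: restr_eq_iff fun_eq_iff)
  then have "closed (\<Union>x\<in>S. {x})"
    using assms by (intro closed_UN) (auto simp: closure_eq)
  then show ?thesis
    by simp
qed

section \<open>Haar measure and null sets of the Cantor space\<close>

interpretation haar: product_prob_space "\<lambda>_. uniform_count_measure (UNIV :: bool set)" "UNIV :: nat set"
  by (intro product_prob_spaceI prob_space_uniform_count_measure) auto

lemma prob_space_haar_cantor: "prob_space haar_cantor"
  unfolding haar_cantor_def by (rule haar.prob_space_axioms)

lemma space_haar_cantor [simp]: "space haar_cantor = UNIV"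
  by (auto simp: haar_cantor_def space_PiM space_uniform_count_measure)

lemma cylinder_eq:
  "{x. restr x (length s) = s} = {x \<in> space haar_cantor. \<forall>i\<in>{..<length s}. x i \<in> {s ! i}}"
  using restr_eq_iff[of _ "length s" "(!) s"] by (auto simp: restr_nth)

lemma sets_cylinder: "{x. restr x (length s) = s} \<in> sets haar_cantor"
  unfolding cylinder_eq haar_cantor_def
  by (intro sets.sets_Collect_finite_All sets_Collect_single)
     (auto simp: sets_uniform_count_measure)

lemma measure_cylinder: "measure haar_cantor {x. restr x (length s) = s} = 1 / 2 ^ length s"
proof -
  have "emeasure haar_cantor {x. restr x (length s) = s}
      = (\<Prod>i\<in>{..<length s}. emeasure (uniform_count_measure UNIV) {s ! i})"
    unfolding cylinder_eq haar_cantor_def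
    by (rule haar.emeasure_PiM_Collect) (auto simp: sets_uniform_count_measure)
  also have "\<dots> = (\<Prod>i\<in>{..<length s}. ennreal (1/2))"
    by (intro prod.cong refl) (simp add: emeasure_uniform_count_measure)
  also have "\<dots> = ennreal (1/2) ^ length s"
    by simp
  also have "\<dots> = ennreal ((1/2) ^ length s)"
    by (rule ennreal_power) simp
  finally show ?thesis
    by (simp add: measure_def power_one_over)
qed

text \<open>The set is a disjoint union of cylinders of measure \<open>1 / 2 ^ k\<close>, so its
  measure reduces to counting nodes.\<close>

lemma
  assumes S: "finite S" "\<And>s. s \<in> S \<Longrightarrow> length s = k"
  shows sets_clopen: "{x. restr x k \<in> S} \<in> sets haar_cantor"
    and measure_clopen: "measure haar_cantor {x. restr x k \<in> S} = card S / 2 ^ k"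
proof -
  interpret h: prob_space haar_cantor
    by (rule prob_space_haar_cantor)
  have sets: "{x. restr x k = s} \<in> sets haar_cantor" if "s \<in> S" for s
    using sets_cylinder[of s] S(2)[OF that] by simp
  have eq: "{x. restr x k \<in> S} = (\<Union>s\<in>S. {x. restr x k = s})"
    by auto
  show "{x. restr x k \<in> S} \<in> sets haar_cantor"
    unfolding eq using S(1) sets by (intro sets.finite_UN) auto
  have "measure haar_cantor {x. restr x k \<in> S} = (\<Sum>s\<in>S. measure haar_cantor {x. restr x k = s})"
    unfolding eq using S(1) sets
    by (intro h.finite_measure_finite_Union) (auto simp: disjoint_family_on_def)
  also have "\<dots> = (\<Sum>s\<in>S. 1 / 2 ^ k)"
    using measure_cylinder S(2) by (intro sum.cong) auto
  finally show "measure haar_cantor {x. restr x k \<in> S} = card S / 2 ^ k"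
    by simp
qed

lemma null_ideal_subset: "A \<in> null_ideal \<Longrightarrow> B \<subseteq> A \<Longrightarrow> B \<in> null_ideal"
  unfolding null_ideal_def by (rule null_sets_completion_subset)

text \<open>The clopen sets of points sharing their first \<open>k\<close> values with a member of
  \<open>S\<close> decrease to the closure, so continuity from above gives its measure as a limit of
  clopen measures.\<close>

lemma closure_null_iff:
  "closure S \<in> null_ideal \<longleftrightarrow>
    (\<lambda>k. measure haar_cantor {x. restr x k \<in> (\<lambda>y. restr y k) ` S}) \<longlonglongrightarrow> 0"
proof -
  interpret h: prob_space haar_cantor
    by (rule prob_space_haar_cantor)
  define K where "K k = {x. restr x k \<in> (\<lambda>y. restr y k) ` S}" for k
  have "finite ((\<lambda>y. restr y k) ` S)" for k
    by (rule finite_subset[OF _ finite_lists_length_eq[of UNIV k]]) auto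
  then have sets: "K k \<in> sets haar_cantor" for k
    unfolding K_def by (intro sets_clopen) auto
  have "decseq K"
    unfolding K_def decseq_def by (force dest: restr_eq_mono)
  then have "(\<lambda>k. measure haar_cantor (K k)) \<longlonglongrightarrow> measure haar_cantor (\<Inter>k. K k)"
    using sets by (intro h.finite_Lim_measure_decseq) auto
  moreover have cl: "closure S = (\<Inter>k. K k)"
    unfolding closure_cantor K_def by (auto simp: image_iff) metis+
  \<comment> \<open>For a measurable set, nullness in the completion is nullness in
    \<open>haar_cantor\<close>.\<close>
  moreover have "closure S \<in> sets haar_cantor"
    unfolding cl using sets by (intro sets.countable_INT) auto
  ultimately show ?thesis
    unfolding null_ideal_def K_def
    by (auto simp: null_sets_completion_iff h.emeasure_eq_measure null_sets_def LIMSEQ_unique)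
qed

lemma countable_null_ideal:
  assumes "countable S"
  shows "S \<in> null_ideal"
proof -
  have "{x} \<in> null_ideal" for x
  proof -
    have "measure haar_cantor {y. restr y k \<in> (\<lambda>y. restr y k) ` {x}} = (1/2) ^ k" for k
      using measure_clopen[of "{restr x k}" k] by (simp add: power_one_over)
    then have "closure {x} \<in> null_ideal"
      unfolding closure_null_iff by (simp add: LIMSEQ_power_zero)
    then show ?thesis
      using null_ideal_subset closure_subset by blast
  qed
  then have "(\<Union>x\<in>S. {x}) \<in> null_ideal"
    using assms unfolding null_ideal_def by (intro null_sets_UN') auto
  then show ?thesis
    by simp
qed

section \<open>Trees and maps into the Cantor space\<close>

lemma in_filter_mono: "in_filter A U \<Longrightarrow> A \<subseteq> B \<Longrightarrow> in_filter B U"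
  unfolding in_filter_def by (auto elim: eventually_mono)

text \<open>No finite errors occur here: restrictions of one point are coherent, and each
  \<open>f n\<close> has one restriction of every length.\<close>

lemma tree_of_sets_preimages: "tree_of_sets (\<lambda>s. {n. restr (f n) (length s) = s})"
proof -
  have "finite ({n. restr (f n) (length s) = s} - {n. restr (f n) (length t) = t})"
    if prefix: "prefix t s" for s t
  proof -
    obtain u where "s = t @ u"
      using prefix by (auto elim: prefixE)
    then have "restr (f n) (length t) = t" if "restr (f n) (length s) = s" for n
      using take_restr[of "length t" "length s" "f n"] that by simp
    then have "{n. restr (f n) (length s) = s} - {n. restr (f n) (length t) = t} = {}"
      by blast
    then show ?thesis
      by (simp only: finite.emptyI)
  qed
  moreover have "{n. restr (f n) (length s) = s} \<inter> {n. restr (f n) (length t) = t} = {}"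
    if "length t = length s" "s \<noteq> t" for s t
    using that by auto
  moreover have "(\<Union>s\<in>{s. length s = k}. {n. restr (f n) (length s) = s}) = UNIV" for k
    by auto
  ultimately show ?thesis
    unfolding tree_of_sets_def almost_subset_def almost_eq_def by simp
qed

text \<open>If \<open>x\<close> is no branch, some cylinder around it contains \<open>f n\<close>
  for only finitely many \<open>n\<close> in \<open>X\<close>. Those values together with the
  complement of the cylinder form a closed set containing the image of \<open>X\<close>, so
  \<open>x\<close> is one of the values.\<close>

lemma closure_image_subset_branches:
  "closure (f ` X) \<subseteq> tree_branches (\<lambda>s. {n. restr (f n) (length s) = s}) X \<union> range f"
proof
  fix x assume x: "x \<in> closure (f ` X)"
  show "x \<in> tree_branches (\<lambda>s. {n. restr (f n) (length s) = s}) X \<union> range f"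
  proof (cases "\<exists>k. finite ({n. restr (f n) k = restr x k} \<inter> X)")
    case True
    then obtain k where k: "finite ({n. restr (f n) k = restr x k} \<inter> X)" (is "finite ?Y")
      by auto
    have "f ` X \<subseteq> f ` ?Y \<union> - {y. restr y k = restr x k}"
      by auto
    moreover have "closed (f ` ?Y \<union> - {y. restr y k = restr x k})"
      using k by (intro closed_Un finite_closed_cantor closed_Compl open_cylinder) auto
    ultimately have "x \<in> f ` ?Y \<union> - {y. restr y k = restr x k}"
      using x closure_minimal by blast
    then show ?thesis
      by auto
  qed (simp add: tree_branches_def)
qed

lemma N_diagonalizes_trees_imp_measure_zero:
  assumes "ultrafilter U" "N_diagonalizes_trees U"
  shows "measure_zero_ultrafilter U"
  unfolding measure_zero_ultrafilter_def
proof (intro conjI allI)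
  fix f :: "nat \<Rightarrow> nat \<Rightarrow> bool"
  obtain X where X: "in_filter X U"
      "tree_branches (\<lambda>s. {n. restr (f n) (length s) = s}) X \<in> null_ideal"
    using assms(2) tree_of_sets_preimages[of f] unfolding N_diagonalizes_trees_def by blast
  have "range f \<in> null_ideal"
    by (rule countable_null_ideal) simp
  with X(2) have "tree_branches (\<lambda>s. {n. restr (f n) (length s) = s}) X \<union> range f \<in> null_ideal"
    unfolding null_ideal_def by (rule null_sets.Un)
  then show "\<exists>X. in_filter X U \<and> closure (f ` X) \<in> null_ideal"
    using X(1) closure_image_subset_branches null_ideal_subset by blast
qed (fact assms)

text \<open>Finitely many tree conditions concern levels up to \<open>k\<close>, and each fails at
  finitely many \<open>n\<close>.\<close>

lemma tree_level_eventually: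
  assumes "tree_of_sets T"
  shows "finite {n. \<not> (\<exists>g. \<forall>s. length s \<le> k \<longrightarrow> (n \<in> T s \<longleftrightarrow> s = restr g (length s)))}"
proof -
  define L where "L = {s :: bool list. length s \<le> k}"
  have "finite L"
    unfolding L_def using finite_lists_length_le[of "UNIV :: bool set" k] by simp
  \<comment> \<open>The three unions collect the failures of monotonicity, covering and
    disjointness.\<close>
  define Bad where "Bad = (\<Union>s\<in>L. \<Union>t\<in>L. if prefix t s then T s - T t else {})
    \<union> (\<Union>j\<le>k. UNIV - (\<Union>s\<in>{s. length s = j}. T s))
    \<union> (\<Union>s\<in>L. \<Union>t\<in>L. if length s = length t \<and> s \<noteq> t then T s \<inter> T t else {})"
  have "finite Bad"
    using assms \<open>finite L\<close>
    unfolding Bad_def tree_of_sets_def almost_subset_def almost_eq_def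
    by (intro finite_UnI finite_UN_I) auto
  moreover have "\<exists>g. \<forall>s. length s \<le> k \<longrightarrow> (n \<in> T s \<longleftrightarrow> s = restr g (length s))" if n: "n \<notin> Bad" for n
  proof -
    have "n \<in> (\<Union>s\<in>{s. length s = k}. T s)"
      using n unfolding Bad_def by blast
    then obtain u where u: "length u = k" "n \<in> T u"
      by blast
    \<comment> \<open>The node \<open>u\<close> decides all levels up to \<open>k\<close>: its
      initial segments contain \<open>n\<close> by monotonicity, other nodes of the same lengths do
      not by disjointness.\<close>
    have "n \<in> T s \<longleftrightarrow> s = restr ((!) u) (length s)" if s: "length s \<le> k" for s
    proof -
      define t where "t = restr ((!) u) (length s)"
      have "prefix t u"
        using prefix_restr[of "length s" "length u" "(!) u"] s u(1)
        unfolding restr_nth t_def by simp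
      moreover have L: "t \<in> L" "u \<in> L" "s \<in> L" "length s = length t"
        using s u(1) by (simp_all add: L_def t_def)
      moreover have "n \<notin> (if prefix t u then T u - T t else {})"
          "n \<notin> (if length s = length t \<and> s \<noteq> t then T s \<inter> T t else {})"
        using n L unfolding Bad_def by blast+
      ultimately have "n \<in> T t" "s \<noteq> t \<Longrightarrow> n \<notin> T s"
        using u(2) by (auto split: if_splits)
      then show ?thesis
        unfolding t_def by auto
    qed
    then show ?thesis
      by blast
  qed
  then have "{n. \<not> (\<exists>g. \<forall>s. length s \<le> k \<longrightarrow> (n \<in> T s \<longleftrightarrow> s = restr g (length s)))} \<subseteq> Bad"
    by blast
  ultimately show ?thesis
    using finite_subset by blast
qed

text \<open>Each \<open>n\<close> is sent to a point following the branch of the tree through \<open>n\<close> for as long as, up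
  to level \<open>n\<close>, the tree is a genuine tree of partitions at \<open>n\<close>.\<close>

lemma tree_of_sets_map:
  assumes "tree_of_sets T"
  obtains f where "\<And>s. almost_subset (T s) {n. restr (f n) (length s) = s}"
proof -
  define P where "P n k g \<longleftrightarrow> (\<forall>s. length s \<le> k \<longrightarrow> (n \<in> T s \<longleftrightarrow> s = restr g (length s)))" for n k g
  \<comment> \<open>The bound \<open>k \<le> n\<close> makes the greatest level exist even where the
    tree is genuine at every level; if no level works, \<open>f n\<close> is unspecified.\<close>
  define f where "f n = (SOME g. P n (GREATEST k. k \<le> n \<and> (\<exists>g. P n k g)) g)" for n
  have f: "P n k (f n)" if "k \<le> n" "P n k g" for n k g
  proof -
    let ?K = "GREATEST k. k \<le> n \<and> (\<exists>g. P n k g)"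
    have "?K \<le> n \<and> (\<exists>g. P n ?K g)"
      by (rule GreatestI_nat[where b = n]) (use that in auto)
    then have "P n ?K (f n)"
      unfolding f_def by (metis someI_ex)
    moreover have "k \<le> ?K"
      by (rule Greatest_le_nat[where b = n]) (use that in auto)
    ultimately show ?thesis
      unfolding P_def by auto
  qed
  have "almost_subset (T s) {n. restr (f n) (length s) = s}" for s
    unfolding almost_subset_def
  proof (rule finite_subset)
    \<comment> \<open>The cutoff at level \<open>n\<close> can spoil \<open>n < length s\<close>; at
      the other exceptions the tree is not genuine up to level \<open>length s\<close>.\<close>
    show "finite ({..<length s} \<union> {n. \<not> (\<exists>g. P n (length s) g)})"
      using tree_level_eventually[OF assms] unfolding P_def by auto
    have "restr (f n) (length s) = s" if "n \<in> T s" "length s \<le> n" "P n (length s) g" for n g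
      using f[OF that(2,3)] that(1) unfolding P_def by auto
    then show "T s - {n. restr (f n) (length s) = s} \<subseteq> {..<length s} \<union> {n. \<not> (\<exists>g. P n (length s) g)}"
      using not_less by blast
  qed
  then show ?thesis
    using that by blast
qed

text \<open>Finitely many elements cannot exhaust an infinite
  \<open>T (restr x k) \<inter> X\<close>, so it has an element that \<open>f\<close> maps into the
  cylinder of \<open>restr x k\<close>; branches therefore lie in the closure.\<close>

lemma measure_zero_imp_N_diagonalizes_trees:
  assumes "measure_zero_ultrafilter U"
  shows "N_diagonalizes_trees U"
  unfolding N_diagonalizes_trees_def
proof (intro allI impI)
  fix T assume "tree_of_sets T"
  then obtain f where f: "\<And>s. almost_subset (T s) {n. restr (f n) (length s) = s}"
    using tree_of_sets_map by blast
  obtain X where X: "in_filter X U" "closure (f ` X) \<in> null_ideal"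
    using assms unfolding measure_zero_ultrafilter_def by blast
  have "tree_branches T X \<subseteq> closure (f ` X)"
    unfolding closure_cantor
  proof (intro subsetI CollectI allI)
    fix x k assume "x \<in> tree_branches T X"
    then have "infinite (T (restr x k) \<inter> X)"
      by (simp add: tree_branches_def)
    moreover have "finite (T (restr x k) - {n. restr (f n) k = restr x k})"
      using f[of "restr x k"] by (simp add: almost_subset_def)
    ultimately have "\<not> T (restr x k) \<inter> X \<subseteq> T (restr x k) - {n. restr (f n) k = restr x k}"
      using finite_subset by blast
    then show "\<exists>y\<in>f ` X. restr y k = restr x k"
      by auto
  qed
  then show "\<exists>X. in_filter X U \<and> tree_branches T X \<in> null_ideal"
    using X null_ideal_subset by blast
qed

section \<open>Finitely additive measures\<close>

text \<open>Total on subsets and real valued, so that no measurability is tracked; the intended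
  instance is \<open>measure \<nu> (remainder A)\<close>.\<close>

locale charge =
  fixes m :: "'a set \<Rightarrow> real"
  assumes nonneg: "0 \<le> m A"
    and additive: "A \<inter> B = {} \<Longrightarrow> m (A \<union> B) = m A + m B"
begin

lemma empty [simp]: "m {} = 0"
  using additive[of "{}" "{}"] by simp

lemma diff: "B \<subseteq> A \<Longrightarrow> m (A - B) = m A - m B"
  using additive[of B "A - B"] by (auto simp: Un_absorb1)

lemma mono: "A \<subseteq> B \<Longrightarrow> m A \<le> m B"
  using diff[of A B] nonneg[of "B - A"] by simp

lemma subadditive: "m (A \<union> B) \<le> m A + m B"
  using additive[of A "B - A"] mono[of "B - A" B] by simp

lemma subadditive_UN: "finite I \<Longrightarrow> m (\<Union>i\<in>I. A i) \<le> (\<Sum>i\<in>I. m (A i))"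
proof (induction I rule: finite_induct)
  case (insert i I)
  then show ?case
    using subadditive[of "A i" "\<Union>i\<in>I. A i"] by simp
qed simp

text \<open>Pieces of \<open>F\<close> are added to \<open>B\<close> one by one; the first to lift
  the charge above \<open>c\<close> adds less than \<open>e\<close>, so the sets before and after it
  enclose \<open>c\<close>. If none does, \<open>B\<close> grows to \<open>C\<close>. An empty
  \<open>F\<close> says nothing about the sign of \<open>e\<close>, hence
  \<open>max 0 e\<close>.\<close>

lemma squeeze_step:
  assumes "finite F" "\<And>A. A \<in> F \<Longrightarrow> m A < e" "B \<subseteq> C" "C \<subseteq> B \<union> \<Union>F" "m B \<le> c" "c \<le> m C"
  shows "\<exists>B' C'. B \<subseteq> B' \<and> B' \<subseteq> C' \<and> C' \<subseteq> C \<and> m B' \<le> c \<and> c \<le> m C' \<and> m C' \<le> m B' + max 0 e"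
  using assms
proof (induction F arbitrary: B rule: finite_induct)
  case empty
  then show ?case by (intro exI[of _ B]) auto
next
  case (insert A F)
  let ?B = "B \<union> (A \<inter> C)"
  show ?case
  proof (cases "m ?B \<le> c")
    case True
    have "\<exists>B' C'. ?B \<subseteq> B' \<and> B' \<subseteq> C' \<and> C' \<subseteq> C \<and> m B' \<le> c \<and> c \<le> m C' \<and> m C' \<le> m B' + max 0 e"
      by (rule insert.IH) (use insert.prems True in auto)
    then obtain B' C' where "?B \<subseteq> B'" "B' \<subseteq> C'" "C' \<subseteq> C" "m B' \<le> c" "c \<le> m C'"
        "m C' \<le> m B' + max 0 e"
      by (elim exE conjE)
    then show ?thesis
      by (intro exI[of _ B'] exI[of _ C']) simp
  next
    case False
    have "m ?B \<le> m B + m (A \<inter> C)" "m (A \<inter> C) \<le> m A" "m A < e"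
      using subadditive mono insert.prems by auto
    then have "m ?B \<le> m B + max 0 e"
      by linarith
    then show ?thesis
      using False insert.prems(2,4) by (intro exI[of _ B] exI[of _ ?B]) auto
  qed
qed

end

text \<open>Strong continuity, the finitely additive form of having no atoms.\<close>

locale continuous_charge = charge +
  assumes small_cover: "0 < e \<Longrightarrow> \<exists>F. finite F \<and> \<Union>F = UNIV \<and> (\<forall>A\<in>F. m A < e)"
begin

lemma squeeze:
  assumes "0 < e" "B \<subseteq> C" "m B \<le> c" "c \<le> m C"
  shows "\<exists>B' C'. B \<subseteq> B' \<and> B' \<subseteq> C' \<and> C' \<subseteq> C \<and> m B' \<le> c \<and> c \<le> m C' \<and> m C' \<le> m B' + e"
proof -
  obtain F where "finite F" "\<Union>F = UNIV" "\<forall>A\<in>F. m A < e"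
    using small_cover[OF assms(1)] by blast
  moreover have "max 0 e = e"
    using assms(1) by simp
  ultimately show ?thesis
    using squeeze_step[of F e B C c] assms(2-4) by simp
qed

text \<open>Squeezing with errors tending to \<open>0\<close> gives increasing inner and decreasing
  outer sets. The union of the inner sets stays inside every outer set, so monotonicity fixes its
  charge.\<close>

lemma intermediate_value:
  assumes "0 \<le> c" "c \<le> m A"
  obtains B where "B \<subseteq> A" "m B = c"
proof -
  define P where "P n p \<longleftrightarrow> fst p \<subseteq> snd p \<and> snd p \<subseteq> A \<and> m (fst p) \<le> c \<and> c \<le> m (snd p)
      \<and> m (snd p) \<le> m (fst p) + inverse (real (Suc n))" for n p
  have "\<exists>p. P 0 p"
  proof -
    obtain B C where "B \<subseteq> C" "C \<subseteq> A" "m B \<le> c" "c \<le> m C" "m C \<le> m B + 1"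
      using squeeze[of 1 "{}" A c] assms by auto
    then show ?thesis
      by (intro exI[of _ "(B, C)"]) (simp add: P_def)
  qed
  moreover have "\<exists>q. P (Suc n) q \<and> fst p \<subseteq> fst q \<and> snd q \<subseteq> snd p" if step: "P n p" for n p
  proof -
    obtain B C where "fst p \<subseteq> B" "B \<subseteq> C" "C \<subseteq> snd p" "m B \<le> c" "c \<le> m C"
        "m C \<le> m B + inverse (real (Suc (Suc n)))"
      using squeeze[of "inverse (real (Suc (Suc n)))" "fst p" "snd p" c] step
      by (auto simp: P_def)
    then show ?thesis
      using step by (intro exI[of _ "(B, C)"]) (auto simp: P_def)
  qed
  ultimately obtain p where p: "\<And>n. P n (p n)"
      "\<And>n. fst (p n) \<subseteq> fst (p (Suc n)) \<and> snd (p (Suc n)) \<subseteq> snd (p n)"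
    using dependent_nat_choice[of P "\<lambda>n p q. fst p \<subseteq> fst q \<and> snd q \<subseteq> snd p"] by blast
  define B where "B = (\<Union>n. fst (p n))"
  have "fst (p i) \<subseteq> snd (p j)" for i j
  proof -
    have "fst (p i) \<subseteq> fst (p (max i j))"
      using lift_Suc_mono_le[of "\<lambda>n. fst (p n)" i "max i j"] p(2) by simp
    also have "\<dots> \<subseteq> snd (p (max i j))"
      using p(1) by (simp add: P_def)
    also have "\<dots> \<subseteq> snd (p j)"
      using lift_Suc_antimono_le[of "\<lambda>n. snd (p n)" j "max i j"] p(2) by simp
    finally show ?thesis .
  qed
  then have B: "fst (p n) \<subseteq> B" "B \<subseteq> snd (p n)" for n
    by (auto simp: B_def)
  have "\<bar>m B - c\<bar> \<le> inverse (real (Suc n))" for n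
    using mono[OF B(1)[of n]] mono[OF B(2)[of n]] p(1)[of n] unfolding P_def by linarith
  then have "\<bar>m B - c\<bar> \<le> 0"
    by (intro LIMSEQ_le_const[OF LIMSEQ_inverse_real_of_nat]) auto
  moreover have "B \<subseteq> A"
    using B(2)[of 0] p(1)[of 0] by (auto simp: P_def)
  ultimately show ?thesis
    using that by auto
qed

text \<open>Repeated halving yields a binary tree of sets, and \<open>f x\<close> records the branch
  through \<open>x\<close>.\<close>

lemma dyadic_map:
  obtains f where "\<And>s. m {x. restr (f x) (length s) = s} = m UNIV / 2 ^ length s"
proof -
  have "\<exists>B. B \<subseteq> A \<and> m B = m A / 2" for A
    using intermediate_value[of "m A / 2" A] nonneg[of A] by auto
  then obtain h where h: "\<And>A. h A \<subseteq> A" "\<And>A. m (h A) = m A / 2"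
    by metis
  \<comment> \<open>Children are formed by consing, so nodes list the newest bit first; this is why
    \<open>rev\<close> appears below.\<close>
  define T where "T = rec_list UNIV (\<lambda>b s D. if b then h D else D - h D)"
  have T: "T [] = UNIV" "T (b # s) = (if b then h (T s) else T s - h (T s))" for b s
    by (simp_all add: T_def)
  define w where "w x = rec_nat [] (\<lambda>k s. (x \<in> h (T s)) # s)" for x
  have w: "w x 0 = []" "w x (Suc k) = (x \<in> h (T (w x k))) # w x k" for x k
    by (simp_all add: w_def)
  define f where "f x k \<longleftrightarrow> x \<in> h (T (w x k))" for x k
  have restr: "restr (f x) k = rev (w x k)" for x k
    by (induction k) (simp_all add: restr_Suc w f_def restr_def)
  have mem: "x \<in> T s \<longleftrightarrow> w x (length s) = s" for x s
    by (induction s) (use h(1) in \<open>auto simp: T w\<close>)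
  have "m (T s) = m UNIV / 2 ^ length s" for s
    by (induction s) (simp_all add: T h diff)
  moreover have "{x. restr (f x) (length s) = s} = T (rev s)" for s
  proof -
    have "rev (w x (length s)) = s \<longleftrightarrow> w x (length s) = rev s" for x
      by (rule rev_swap)
    then show ?thesis
      using mem[of _ "rev s"] unfolding restr length_rev by blast
  qed
  ultimately show ?thesis
    using that[of f] by simp
qed

text \<open>The nodes met by the image of \<open>X\<close> at level \<open>k\<close> cover
  \<open>X\<close> by pieces of charge \<open>m UNIV / 2 ^ k\<close>, which bounds
  \<open>m X\<close> by a multiple of the Haar measure of a clopen set shrinking to the
  closure.\<close>

lemma map_null_closure:
  obtains f where "\<And>X. closure (f ` X) \<in> null_ideal \<Longrightarrow> m X = 0"
proof -
  obtain f where f: "\<And>s. m {x. restr (f x) (length s) = s} = m UNIV / 2 ^ length s"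
    using dyadic_map by blast
  have "m X = 0" if X: "closure (f ` X) \<in> null_ideal" for X
  proof -
    define S where "S k = (\<lambda>y. restr y k) ` f ` X" for k
    have fin: "finite (S k)" for k
      unfolding S_def by (rule finite_subset[OF _ finite_lists_length_eq[of UNIV k]]) auto
    have len: "length s = k" if "s \<in> S k" for s k
      using that by (auto simp: S_def)
    have "m X \<le> m UNIV * measure haar_cantor {x. restr x k \<in> S k}" for k
    proof -
      have "m X \<le> m (\<Union>s\<in>S k. {x. restr (f x) k = s})"
        by (rule mono) (auto simp: S_def)
      also have "\<dots> \<le> (\<Sum>s\<in>S k. m {x. restr (f x) k = s})"
        using fin by (rule subadditive_UN)
      also have "\<dots> = (\<Sum>s\<in>S k. m UNIV / 2 ^ k)"
        using f len by (intro sum.cong) auto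
      also have "\<dots> = m UNIV * measure haar_cantor {x. restr x k \<in> S k}"
        using measure_clopen[OF fin len] by simp
      finally show ?thesis .
    qed
    moreover have "(\<lambda>k. m UNIV * measure haar_cantor {x. restr x k \<in> S k}) \<longlonglongrightarrow> m UNIV * 0"
      using X unfolding closure_null_iff S_def by (intro tendsto_mult_left)
    ultimately have "m X \<le> m UNIV * 0"
      by (intro LIMSEQ_le_const) auto
    then show ?thesis
      using nonneg[of X] by simp
  qed
  then show ?thesis
    using that by blast
qed

end

section \<open>Ultrafilters\<close>

text \<open>Zorn's lemma extends \<open>S\<close> to a maximal family without finite subcover of
  \<open>UNIV\<close>; this is a maximal ideal, and \<open>V\<close> is its dual filter.\<close>

lemma ultrafilter_avoiding:
  fixes S :: "'a set set"
  assumes "\<And>F. finite F \<Longrightarrow> F \<subseteq> S \<Longrightarrow> \<Union>F \<noteq> UNIV"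
  obtains V where "ultrafilter V" "\<And>A. A \<in> S \<Longrightarrow> \<not> in_filter A V"
proof -
  define \<A> where "\<A> = {C. S \<subseteq> C \<and> (\<forall>F. finite F \<and> F \<subseteq> C \<longrightarrow> \<Union>F \<noteq> (UNIV :: 'a set))}"
  have "\<exists>M\<in>\<A>. \<forall>X\<in>\<A>. M \<subseteq> X \<longrightarrow> X = M"
  proof (rule subset_Zorn_nonempty)
    show "\<A> \<noteq> {}"
      using assms by (auto simp: \<A>_def)
    fix \<C> assume C: "\<C> \<noteq> {}" "subset.chain \<A> \<C>"
    have "\<Union>F \<noteq> UNIV" if F: "finite F" "F \<subseteq> \<Union>\<C>" for F
    proof -
      obtain Y where "Y \<in> \<C>" "F \<subseteq> Y"
        using finite_subset_Union_chain[OF F C] by blast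
      then show ?thesis
        using F(1) C(2) by (auto simp: \<A>_def subset.chain_def)
    qed
    moreover have "S \<subseteq> \<Union>\<C>"
    proof -
      obtain Y where "Y \<in> \<C>" "Y \<in> \<A>"
        using C unfolding subset.chain_def by blast
      then show ?thesis
        unfolding \<A>_def by blast
    qed
    ultimately show "\<Union>\<C> \<in> \<A>"
      unfolding \<A>_def by simp
  qed
  then obtain M where "M \<in> \<A>" and max: "\<And>X. X \<in> \<A> \<Longrightarrow> M \<subseteq> X \<Longrightarrow> X = M"
    by blast
  then have M: "S \<subseteq> M" "\<And>F. finite F \<Longrightarrow> F \<subseteq> M \<Longrightarrow> \<Union>F \<noteq> UNIV"
    by (auto simp: \<A>_def)
  \<comment> \<open>By maximality, adding \<open>A\<close> creates a finite cover, from which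
    \<open>A\<close> is then split off.\<close>
  have cover: "\<exists>F. finite F \<and> F \<subseteq> M \<and> A \<union> \<Union>F = UNIV" if "A \<notin> M" for A
  proof -
    have "insert A M \<notin> \<A>"
      using max[of "insert A M"] that by auto
    moreover have "S \<subseteq> insert A M"
      using M(1) by auto
    ultimately obtain F where "\<not> (finite F \<and> F \<subseteq> insert A M \<longrightarrow> \<Union>F \<noteq> UNIV)"
      unfolding \<A>_def by blast
    then have "finite (F - {A})" "F - {A} \<subseteq> M" "A \<union> \<Union>(F - {A}) = UNIV"
      by auto
    then show ?thesis
      by (intro exI[of _ "F - {A}"] conjI)
  qed
  \<comment> \<open>Hence \<open>M\<close> is an ideal: otherwise the sets completing
    \<open>A\<close> to a cover would cover \<open>UNIV\<close> together with
    \<open>G\<close>.\<close>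
  have closed: "A \<in> M" if "finite G" "G \<subseteq> M" "A \<subseteq> \<Union>G" for A G
  proof (rule ccontr)
    assume "A \<notin> M"
    then obtain F where "finite F" "F \<subseteq> M" "A \<union> \<Union>F = UNIV"
      using cover[OF \<open>A \<notin> M\<close>] by (elim exE conjE)
    moreover from this have "\<Union>(F \<union> G) = UNIV"
      using that(3) unfolding Union_Un_distrib by blast
    ultimately show False
      using M(2)[of "F \<union> G"] that(1,2) by simp
  qed
  define V where "V = Abs_filter (\<lambda>P. {n. \<not> P n} \<in> M)"
  have "is_filter (\<lambda>P. {n. \<not> P n} \<in> M)"
  proof
    show "{n. \<not> True} \<in> M"
      by (rule closed[of "{}"]) auto
    show "{n. \<not> (P n \<and> Q n)} \<in> M" if "{n. \<not> P n} \<in> M" "{n. \<not> Q n} \<in> M" for P Q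
      by (rule closed[of "{{n. \<not> P n}, {n. \<not> Q n}}"]) (use that in auto)
    show "\<forall>x. P x \<longrightarrow> Q x \<Longrightarrow> {n. \<not> P n} \<in> M \<Longrightarrow> {n. \<not> Q n} \<in> M" for P Q
      by (rule closed[of "{{n. \<not> P n}}"]) auto
  qed
  then have "eventually P V \<longleftrightarrow> {n. \<not> P n} \<in> M" for P
    unfolding V_def by (rule eventually_Abs_filter)
  then have V: "in_filter A V \<longleftrightarrow> - A \<in> M" for A
    unfolding in_filter_def Compl_eq by simp
  have notboth: "\<not> (A \<in> M \<and> - A \<in> M)" for A
    using M(2)[of "{A, - A}"] by auto
  \<comment> \<open>Primeness: the sets completing \<open>A\<close> and \<open>- A\<close> to covers
    would jointly cover \<open>UNIV\<close> from within \<open>M\<close>.\<close>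
  have "A \<in> M \<or> - A \<in> M" for A
  proof (rule ccontr)
    assume "\<not> ?thesis"
    then have "A \<notin> M" "- A \<notin> M"
      by auto
    from cover[OF this(1)] cover[OF this(2)]
    obtain F G where "finite F" "F \<subseteq> M" "A \<union> \<Union>F = UNIV"
        "finite G" "G \<subseteq> M" "- A \<union> \<Union>G = UNIV"
      by (elim exE conjE)
    moreover from this have "\<Union>(F \<union> G) = UNIV"
      unfolding Union_Un_distrib by blast
    ultimately show False
      using M(2)[of "F \<union> G"] by simp
  qed
  moreover have "V \<noteq> bot"
    using V[of "{}"] notboth[of "{}"] closed[of "{}" "{}"] by (auto simp: in_filter_def)
  ultimately have "ultrafilter V"
    unfolding ultrafilter_def V by (metis double_complement)
  then show ?thesis
    using that[of V] V notboth M(1) by auto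
qed

section \<open>Membership calculus for ultrafilters\<close>

lemma in_filter_Int: "in_filter (A \<inter> B) U \<longleftrightarrow> in_filter A U \<and> in_filter B U"
  by (simp add: in_filter_def eventually_conj_iff)

lemma in_filter_empty: "ultrafilter U \<Longrightarrow> \<not> in_filter {} U"
  by (simp add: in_filter_def ultrafilter_def eventually_False)

lemma in_filter_UNIV: "in_filter UNIV U"
  by (simp add: in_filter_def)

lemma in_filter_Compl: "ultrafilter U \<Longrightarrow> in_filter (- A) U \<longleftrightarrow> \<not> in_filter A U"
  using in_filter_empty[of U] in_filter_Int[of A "- A" U] by (auto simp: ultrafilter_def)

lemma in_filter_Un: "ultrafilter U \<Longrightarrow> in_filter (A \<union> B) U \<longleftrightarrow> in_filter A U \<or> in_filter B U"
  using in_filter_Int[of "- A" "- B" U] in_filter_Compl[of U] by (metis Compl_Un)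

lemma in_filter_Union:
  "finite F \<Longrightarrow> ultrafilter U \<Longrightarrow> in_filter (\<Union>F) U \<longleftrightarrow> (\<exists>A\<in>F. in_filter A U)"
  by (induction F rule: finite_induct) (auto simp: in_filter_Un in_filter_empty)

lemma filter_eqI:
  "(\<And>A. in_filter A U \<longleftrightarrow> in_filter A V) \<Longrightarrow> U = V"
  unfolding filter_eq_iff in_filter_def
proof
  fix P
  assume "\<And>A. eventually (\<lambda>n. n \<in> A) U \<longleftrightarrow> eventually (\<lambda>n. n \<in> A) V"
  from this[of "Collect P"] show "eventually P U \<longleftrightarrow> eventually P V"
    by simp
qed

lemma ultrafilter_eqI:
  assumes "ultrafilter U" "ultrafilter V" "\<And>A. in_filter A U \<Longrightarrow> in_filter A V"
  shows "U = V"
proof (rule filter_eqI)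
  fix A
  show "in_filter A U \<longleftrightarrow> in_filter A V"
    using assms(3)[of A] assms(3)[of "- A"] in_filter_Compl[OF assms(1), of A]
      in_filter_Compl[OF assms(2), of A] by blast
qed

lemma ultrafilter_singleton:
  assumes "ultrafilter U" "in_filter {n} U"
  shows "U = principal {n}"
proof (rule filter_eqI)
  fix A
  have "in_filter A U \<longleftrightarrow> n \<in> A"
  proof
    show "n \<in> A" if "in_filter A U"
      using that assms in_filter_Int[of A "{n}" U] in_filter_empty[of U] by (cases "n \<in> A") auto
    show "in_filter A U" if "n \<in> A"
      using assms(2) by (rule in_filter_mono) (use that in auto)
  qed
  then show "in_filter A U \<longleftrightarrow> in_filter A (principal {n})"
    by (simp add: in_filter_def eventually_principal)
qed

section \<open>Measures on the remainder\<close>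

lemma topspace_omega_star: "topspace omega_star = {V. ultrafilter V \<and> nonprincipal V}"
proof -
  have "topspace beta_omega = {V. ultrafilter V}"
    unfolding beta_omega_def topology_generated_by_topspace using in_filter_UNIV by blast
  then show ?thesis
    unfolding omega_star_def by auto
qed

text \<open>The trace of a basic clopen set of the Stone space, usually written \<open>A^*\<close>.
  Only non-principal ultrafilters remain, so finite sets have empty trace.\<close>

definition remainder :: "nat set \<Rightarrow> nat filter set" where
  "remainder A = {V \<in> topspace omega_star. in_filter A V}"

lemma openin_remainder: "openin omega_star (remainder A)"
proof -
  have "openin beta_omega {U. ultrafilter U \<and> in_filter A U}"
    unfolding beta_omega_def by (rule topology_generated_by_Basis) auto
  then show ?thesis
    unfolding omega_star_def openin_subtopology remainder_def
    using topspace_omega_star omega_star_def by auto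
qed

lemma remainder_Compl: "remainder (- A) = topspace omega_star - remainder A"
  by (auto simp: remainder_def topspace_omega_star in_filter_Compl)

lemma remainder_Un: "remainder (A \<union> B) = remainder A \<union> remainder B"
  by (auto simp: remainder_def topspace_omega_star in_filter_Un)

lemma remainder_Union: "finite F \<Longrightarrow> remainder (\<Union>F) = (\<Union>A\<in>F. remainder A)"
  by (auto simp: remainder_def topspace_omega_star in_filter_Union)

lemma remainder_disjoint: "A \<inter> B = {} \<Longrightarrow> remainder A \<inter> remainder B = {}"
  using in_filter_Int[of A B] in_filter_empty by (fastforce simp: remainder_def topspace_omega_star)

lemma remainder_singleton: "remainder {n} = {}"
  by (auto simp: remainder_def topspace_omega_star nonprincipal_def dest: ultrafilter_singleton)

lemma closedin_remainder: "closedin omega_star (remainder A)"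
  using openin_remainder[of "- A"] unfolding remainder_Compl closedin_def by (auto simp: remainder_def)

text \<open>Two distinct ultrafilters are separated by a set. The union shows the complement of a
  point to be open and supplies the open cover to which compactness is applied.\<close>

lemma UN_remainder_avoiding:
  assumes "V \<in> topspace omega_star"
  shows "(\<Union>A\<in>{A. \<not> in_filter A V}. remainder A) = topspace omega_star - {V}"
proof -
  have "\<exists>A. \<not> in_filter A V \<and> in_filter A W" if "W \<in> topspace omega_star" "W \<noteq> V" for W
    using that assms ultrafilter_eqI[of W V] by (auto simp: topspace_omega_star)
  then show ?thesis
    by (auto simp: remainder_def)
qed

text \<open>The set \<open>{V}\<close> is null, so inner regularity gives a compact \<open>K\<close>
  missing \<open>V\<close> of measure above \<open>1 - e\<close>. Finitely many basic sets, none
  indexed by a member of \<open>V\<close>, cover \<open>K\<close>; the complement of the union of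
  their indices belongs to \<open>V\<close> and has small trace.\<close>

lemma radon_remainder_small:
  assumes "radon_probability omega_star \<nu>" "non_atomic omega_star \<nu>"
    and V: "V \<in> topspace omega_star" and "0 < e"
  obtains A where "in_filter A V" "measure \<nu> (remainder A) < e"
proof -
  interpret prob_space \<nu>
    using assms by (simp add: radon_probability_def)
  have space: "space \<nu> = topspace omega_star"
    and sets: "sets \<nu> = sigma_sets (topspace omega_star) {G. openin omega_star G}"
    and radon: "\<And>B. B \<in> sets \<nu> \<Longrightarrow> emeasure \<nu> B =
        (SUP K\<in>{K. compactin omega_star K \<and> K \<in> sets \<nu> \<and> K \<subseteq> B}. emeasure \<nu> K)"
    using assms by (auto simp: radon_probability_def)
  have openS: "G \<in> sets \<nu>" if "openin omega_star G" for G
    using that unfolding sets by (auto intro: sigma_sets.Basic)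
  let ?G = "topspace omega_star - {V}"
  have "openin omega_star ?G"
    unfolding UN_remainder_avoiding[OF V, symmetric] using openin_remainder by auto
  then have G: "?G \<in> sets \<nu>"
    by (rule openS)
  then have "{V} \<in> sets \<nu>"
    using sets.compl_sets[OF G] V unfolding space by (simp add: Diff_Diff_Int Int_absorb1)
  moreover have "measure \<nu> {V} = 0"
    using assms(2) V by (simp add: non_atomic_def measure_def)
  ultimately have "measure \<nu> ?G = 1"
    using prob_compl[of "{V}"] unfolding space by simp
  then have "ennreal (1 - e) < emeasure \<nu> ?G"
    using \<open>0 < e\<close> by (simp add: emeasure_eq_measure ennreal_less_one_iff)
  then obtain K where K: "compactin omega_star K" "K \<in> sets \<nu>" "K \<subseteq> ?G" "ennreal (1 - e) < emeasure \<nu> K"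
    unfolding radon[OF G] less_SUP_iff by blast
  have "K \<subseteq> \<Union>(remainder ` {A. \<not> in_filter A V})"
    using K(3) UN_remainder_avoiding[OF V] by simp
  then obtain \<F> where \<F>: "finite \<F>" "\<F> \<subseteq> remainder ` {A. \<not> in_filter A V}" "K \<subseteq> \<Union>\<F>"
    using compactinD[OF K(1), of "remainder ` {A. \<not> in_filter A V}"] openin_remainder by auto
  obtain F where "finite F" "F \<subseteq> {A. \<not> in_filter A V}" "\<F> = remainder ` F"
    using finite_subset_image[OF \<F>(1,2)] by (elim exE conjE)
  with \<F>(3) have F: "finite F" "F \<subseteq> {A. \<not> in_filter A V}" "K \<subseteq> \<Union>(remainder ` F)"
    by simp_all
  have "measure \<nu> K \<le> measure \<nu> (remainder (\<Union>F))"
    using F K(2) openS openin_remainder by (intro finite_measure_mono) (auto simp: remainder_Union)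
  \<comment> \<open>For \<open>1 < e\<close> the value \<open>ennreal (1 - e)\<close> is truncated
    to \<open>0\<close>, hence the case split.\<close>
  moreover have "1 - e < measure \<nu> K"
  proof (cases "1 < e")
    case True
    then show ?thesis
      using measure_nonneg[of \<nu> K] by linarith
  next
    case False
    then show ?thesis
      using K(4) by (simp add: emeasure_eq_measure ennreal_less_iff)
  qed
  moreover have "measure \<nu> (remainder (- \<Union>F)) = 1 - measure \<nu> (remainder (\<Union>F))"
    using prob_compl[OF openS[OF openin_remainder]] unfolding space remainder_Compl by simp
  ultimately have "measure \<nu> (remainder (- \<Union>F)) < e"
    by simp
  moreover have "in_filter (- \<Union>F) V"
    using F V by (auto simp: topspace_omega_star in_filter_Compl in_filter_Union)
  ultimately show ?thesis
    using that by blast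
qed

text \<open>If the sets of small charge had no finite cover, an ultrafilter would avoid them all.
  Singletons have charge \<open>0\<close>, so it would be non-principal, contradicting
  \<open>radon_remainder_small\<close>.\<close>

lemma continuous_charge_remainder:
  assumes "radon_probability omega_star \<nu>" "non_atomic omega_star \<nu>"
  shows "continuous_charge (\<lambda>A. measure \<nu> (remainder A))"
proof -
  interpret prob_space \<nu>
    using assms by (simp add: radon_probability_def)
  have sets: "remainder A \<in> sets \<nu>" for A
    using assms(1) openin_remainder[of A] by (auto simp: radon_probability_def intro: sigma_sets.Basic)
  show ?thesis
  proof
    show "measure \<nu> (remainder (A \<union> B)) = measure \<nu> (remainder A) + measure \<nu> (remainder B)"
      if "A \<inter> B = {}" for A B
      unfolding remainder_Un using sets remainder_disjoint[OF that] by (intro finite_measure_Union)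
    fix e :: real assume "0 < e"
    show "\<exists>F. finite F \<and> \<Union>F = UNIV \<and> (\<forall>A\<in>F. measure \<nu> (remainder A) < e)"
    proof (rule ccontr)
      assume "\<not> ?thesis"
      then have cover: "\<Union>F \<noteq> UNIV" if "finite F" "F \<subseteq> {A. measure \<nu> (remainder A) < e}" for F
        using that by auto
      obtain V where V: "ultrafilter V" "\<And>A. measure \<nu> (remainder A) < e \<Longrightarrow> \<not> in_filter A V"
        using ultrafilter_avoiding[of "{A. measure \<nu> (remainder A) < e}", OF cover] by auto
      have "\<not> in_filter {n} V" for n
        using V(2)[of "{n}"] \<open>0 < e\<close> by (simp add: remainder_singleton)
      then have "V \<noteq> principal {n}" for n
        by (metis in_filter_def eventually_principal singletonD singletonI)
      then have "V \<in> topspace omega_star"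
        using V(1) by (simp add: topspace_omega_star nonprincipal_def)
      then show False
        using radon_remainder_small[OF assms _ \<open>0 < e\<close>] V(2) by blast
    qed
  qed simp
qed

lemma measure_zero_ultrafilter_imp_mu_point:
  assumes "nonprincipal U" "measure_zero_ultrafilter U"
  shows "mu_point omega_star U"
  unfolding mu_point_def
proof (intro conjI allI impI)
  show U: "U \<in> topspace omega_star"
    using assms by (simp add: topspace_omega_star measure_zero_ultrafilter_def)
  fix \<nu> assume "radon_probability omega_star \<nu> \<and> non_atomic omega_star \<nu>"
  then have \<nu>: "radon_probability omega_star \<nu>" "non_atomic omega_star \<nu>"
    by auto
  interpret prob_space \<nu>
    using \<nu> by (simp add: radon_probability_def)
  have sets: "remainder A \<in> sets \<nu>" for A
    using \<nu>(1) openin_remainder[of A] by (auto simp: radon_probability_def intro: sigma_sets.Basic)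
  have space: "space \<nu> = topspace omega_star"
    using \<nu>(1) by (simp add: radon_probability_def)
  interpret continuous_charge "\<lambda>A. measure \<nu> (remainder A)"
    using \<nu> by (rule continuous_charge_remainder)
  obtain f where f: "\<And>X. closure (f ` X) \<in> null_ideal \<Longrightarrow> measure \<nu> (remainder X) = 0"
    using map_null_closure by blast
  obtain X where X: "in_filter X U" "closure (f ` X) \<in> null_ideal"
    using assms(2) unfolding measure_zero_ultrafilter_def by blast
  \<comment> \<open>The image of \<open>X\<close> under \<open>f\<close> has null closure, so
    \<open>X\<close> has charge \<open>0\<close>; its complement supplies one of the closed sets of
    measure \<open>1\<close> that are intersected in the support.\<close>
  have "emeasure \<nu> (remainder (- X)) = 1"
    using f[OF X(2)] prob_compl[OF sets[of X]]
    unfolding space remainder_Compl by (simp add: emeasure_eq_measure)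
  moreover have "U \<notin> remainder (- X)"
    using X(1) U by (auto simp: remainder_def topspace_omega_star in_filter_Compl)
  ultimately show "U \<notin> measure_support omega_star \<nu>"
    unfolding measure_support_def using closedin_remainder by blast
qed

theorem corollary6p8:
  fixes U :: "nat filter"
  assumes "ultrafilter U"
  shows "(N_diagonalizes_trees U \<longleftrightarrow> measure_zero_ultrafilter U) \<and>
         (nonprincipal U \<and> measure_zero_ultrafilter U \<longrightarrow> mu_point omega_star U)"
  using assms N_diagonalizes_trees_imp_measure_zero measure_zero_imp_N_diagonalizes_trees
    measure_zero_ultrafilter_imp_mu_point by blast

end
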